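(* Let $d,l\ge2$ be integers and $0<\beta<1/d$, and assume that either $\beta<\frac{4-\sqrt2}7$ or $d\ge3$. Assume further that $$G_\beta(s)>0\qquad\text{for all }0<s<\beta-c_0(\beta).$$ Then (the continuous extension of) the function $(\rho,\theta)\mapsto\Psi_{d,l}(\beta,\rho,\theta)$ has a unique global maximizer on $\overline{\mathcal R_\beta}$. The maximizer is $(\rho,\theta)=(\beta^2,\,l(d-1)\beta^2)$, and the maximum value is $2\Phi_{d,l}(\beta)$.
   Context: For integers $d,l\ge2$ and $0<\beta<1/d$: $$\Phi_{d,l}(\beta)=-\beta\log\beta+(l-1)(1-\beta)\log(1-\beta)-\tfrac ld(1-d\beta)\log(1-d\beta),$$ $$\mathcal R_\beta:=\left\{(\rho,\theta):0<\rho<\beta,\ \max\left\{0,2l\beta-l\rho-\tfrac ld\right\}<\theta<l\beta-l\rho\right\},$$ and for $(\rho,\theta)\in\mathcal R_\beta$, $$\begin{aligned}\Psi_{d,l}(\beta,\rho,\theta)={}&-\rho\log\rho-\theta\log\tfrac\theta l+(l-1)(1-2\beta+\rho)\log(1-2\beta+\rho)+\theta\log(d-1)\\&+2(l-1)(\beta-\rho)\log(\beta-\rho)-2l\left(\beta-\rho-\tfrac\theta l\right)\log\left(\beta-\rho-\tfrac\theta l\right)\\&-\tfrac ld\left(1-2\beta d+\rho d+\tfrac{\theta d}l\right)\log\left(1-2\beta d+\rho d+\tfrac{\theta d}l\right).\end{aligned}$$ $\Psi_{d,l}(\beta,\cdot,\cdot)$ is extended continuously to the closure $\overline{\mathcal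 R_\beta}$ by the convention $x\log x=0$ at $x=0$. For $0<s<\beta$, $$t_\beta(s):=\frac{(\beta-s)^{1/l}s^{1-2/l}}{(1-\beta-s)^{(l-1)/l}},$$ $$\begin{aligned}G_\beta(s):={}&(1-(d-1)t_\beta(s))(d+l-dl)s^2+2\beta(1-\beta d)(1-\beta)\bigl(1-(d-1)(l-1)t_\beta(s)\bigr)\\&+s\Bigl[-t_\beta(s)(d-1)\bigl(\beta l-3\beta d-2l+2\beta^2d+3\beta dl-2\beta^2dl+1\bigr)\\&\qquad+2\beta^2d-\beta l-\beta d+\beta dl-1\Bigr],\end{aligned}$$ and $$c_0(\beta):=\frac{3\beta l-2l+1+\sqrt{9\beta^2l^2-8\beta^2l-12\beta l^2+10\beta l+4l^2-4l+1}}{2l}\in(0,\beta).$$ *)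

theory Defs
  imports "HOL-Analysis.Analysis" "HOL-Real_Asymp.Real_Asymp"
begin

definition Phi :: "nat \<Rightarrow> nat \<Rightarrow> real \<Rightarrow> real" where
  "Phi d l \<beta> =
     - \<beta> * ln \<beta> + (real l - 1) * (1 - \<beta>) * ln (1 - \<beta>)
     - (real l / real d) * (1 - real d * \<beta>) * ln (1 - real d * \<beta>)"

definition Reg :: "nat \<Rightarrow> nat \<Rightarrow> real \<Rightarrow> (real \<times> real) set" where
  "Reg d l \<beta> = {(\<rho>, \<theta>). 0 < \<rho> \<and> \<rho> < \<beta> \<and>
     max 0 (2 * real l * \<beta> - real l * \<rho> - real l / real d) < \<theta> \<and>
     \<theta> < real l * \<beta> - real l * \<rho>}"

text \<open>
  Every logarithm below is multiplied by its own argument up to a constant factor, so the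
  convention that x log x = 0 at x = 0 holds automatically. Hence the same formula also describes
  the continuous extension to the closure of the region; see \<open>continuous_on_Psi\<close>.
\<close>
definition Psi :: "nat \<Rightarrow> nat \<Rightarrow> real \<Rightarrow> real \<times> real \<Rightarrow> real" where
  "Psi d l \<beta> = (\<lambda>(\<rho>, \<theta>).
     - \<rho> * ln \<rho> - \<theta> * ln (\<theta> / real l)
     + (real l - 1) * (1 - 2 * \<beta> + \<rho>) * ln (1 - 2 * \<beta> + \<rho>)
     + \<theta> * ln (real d - 1)
     + 2 * (real l - 1) * (\<beta> - \<rho>) * ln (\<beta> - \<rho>)
     - 2 * real l * (\<beta> - \<rho> - \<theta> / real l) * ln (\<beta> - \<rho> - \<theta> / real l)
     - (real l / real d)
         * (1 - 2 * \<beta> * real d + \<rho> * real d + \<theta> * real d / real l)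
         * ln (1 - 2 * \<beta> * real d + \<rho> * real d + \<theta> * real d / real l))"

definition t_fun :: "nat \<Rightarrow> real \<Rightarrow> real \<Rightarrow> real" where
  "t_fun l \<beta> s =
     (\<beta> - s) powr (1 / real l) * s powr (1 - 2 / real l)
     / (1 - \<beta> - s) powr ((real l - 1) / real l)"

definition G_fun :: "nat \<Rightarrow> nat \<Rightarrow> real \<Rightarrow> real \<Rightarrow> real" where
  "G_fun d0 l0 \<beta> s =
     (let d = real d0; l = real l0; t = t_fun l0 \<beta> s in
      (1 - (d - 1) * t) * (d + l - d * l) * s\<^sup>2
      + 2 * \<beta> * (1 - \<beta> * d) * (1 - \<beta>) * (1 - (d - 1) * (l - 1) * t)
      + s * (- t * (d - 1) * (\<beta> * l - 3 * \<beta> * d - 2 * l + 2 * \<beta>\<^sup>2 * d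
                              + 3 * \<beta> * d * l - 2 * \<beta>\<^sup>2 * d * l + 1)
             + 2 * \<beta>\<^sup>2 * d - \<beta> * l - \<beta> * d + \<beta> * d * l - 1))"

definition c0 :: "nat \<Rightarrow> real \<Rightarrow> real" where
  "c0 l0 \<beta> =
     (let l = real l0 in
      (3 * \<beta> * l - 2 * l + 1
       + sqrt (9 * \<beta>\<^sup>2 * l\<^sup>2 - 8 * \<beta>\<^sup>2 * l - 12 * \<beta> * l\<^sup>2 + 10 * \<beta> * l
               + 4 * l\<^sup>2 - 4 * l + 1))
      / (2 * l))"

lemma continuous_on_x_ln_x: "continuous_on {0..} (\<lambda>x::real. x * ln x)"
proof -
  have "((\<lambda>x::real. x * ln x) \<longlongrightarrow> 0 * ln 0) (at 0 within {0..})"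
  proof -
    have "((\<lambda>x::real. x * ln x) \<longlongrightarrow> 0) (at_right 0)"
      by real_asymp
    moreover have "at (0::real) within {0..} = at_right 0"
      by (simp add: at_within_Ici_at_right)
    ultimately show ?thesis by simp
  qed
  moreover have "((\<lambda>x::real. x * ln x) \<longlongrightarrow> a * ln a) (at a within {0..})" if "a > 0" for a
    using that by (intro tendsto_intros) auto
  ultimately show ?thesis
    unfolding continuous_on_def by (metis atLeast_iff order_le_less)
qed

lemma continuous_on_Psi:
  assumes "2 \<le> d" "2 \<le> l" "0 < \<beta>" "\<beta> < 1 / real d"
  shows "continuous_on (closure (Reg d l \<beta>)) (Psi d l \<beta>)"
proof -
  define C where "C = {p :: real \<times> real. 0 \<le> fst p \<and> fst p \<le> \<beta> \<and> 0 \<le> snd p \<and>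
     2 * real l * \<beta> - real l * fst p - real l / real d \<le> snd p \<and>
     snd p \<le> real l * \<beta> - real l * fst p}"
  have "closed C"
    unfolding C_def by (intro closed_Collect_conj closed_Collect_le continuous_intros)
  moreover have "Reg d l \<beta> \<subseteq> C"
    by (auto simp: Reg_def C_def)
  ultimately have sub: "closure (Reg d l \<beta>) \<subseteq> C"
    by (simp add: closure_minimal)
  have b2: "2 * \<beta> < 1"
  proof -
    have "1 / real d \<le> 1 / 2" using assms(1) by (simp add: field_simps)
    then show ?thesis using assms(4) by simp
  qed
  have xlx: "continuous_on C (\<lambda>p. f p * ln (f p))"
    if "continuous_on C f" "\<And>p. p \<in> C \<Longrightarrow> 0 \<le> f p" for f :: "real \<times> real \<Rightarrow> real"
    by (rule continuous_on_compose2[OF continuous_on_x_ln_x that(1)]) (use that(2) in auto)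
  have dl: "real d > 0" "real l > 0" using assms by auto
  have nn: "0 \<le> 1 - 2 * \<beta> * real d + fst p * real d + snd p * real d / real l"
    if "p \<in> C" for p
  proof -
    have "0 \<le> real d / real l *
        (snd p - (2 * real l * \<beta> - real l * fst p - real l / real d))"
      using that dl unfolding C_def by (intro mult_nonneg_nonneg) auto
    also have "\<dots> = 1 - 2 * \<beta> * real d + fst p * real d + snd p * real d / real l"
      using dl by (simp add: field_simps)
    finally show ?thesis .
  qed
  have c1: "continuous_on C (\<lambda>p. fst p * ln (fst p))"
    by (rule xlx) (auto simp: C_def intro!: continuous_intros)
  have c2: "continuous_on C (\<lambda>p. snd p / real l * ln (snd p / real l))"
    by (rule xlx) (use dl in \<open>auto simp: C_def intro!: continuous_intros\<close>)
  have c3: "continuous_on C (\<lambda>p. (1 - 2 * \<beta> + fst p) * ln (1 - 2 * \<beta> + fst p))"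
    by (rule xlx) (use b2 in \<open>auto simp: C_def intro!: continuous_intros\<close>)
  have c4: "continuous_on C (\<lambda>p. (\<beta> - fst p) * ln (\<beta> - fst p))"
    by (rule xlx) (auto simp: C_def intro!: continuous_intros)
  have c5: "continuous_on C (\<lambda>p. (\<beta> - fst p - snd p / real l) * ln (\<beta> - fst p - snd p / real l))"
    by (rule xlx) (use dl in \<open>auto simp: C_def field_simps intro!: continuous_intros\<close>)
  have c6: "continuous_on C (\<lambda>p.
      (1 - 2 * \<beta> * real d + fst p * real d + snd p * real d / real l) *
      ln (1 - 2 * \<beta> * real d + fst p * real d + snd p * real d / real l))"
    by (rule xlx[OF _ nn]) (use dl in \<open>auto intro!: continuous_intros\<close>)
  have "continuous_on C (\<lambda>p.
      - (fst p * ln (fst p)) - real l * (snd p / real l * ln (snd p / real l))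
      + (real l - 1) * ((1 - 2 * \<beta> + fst p) * ln (1 - 2 * \<beta> + fst p))
      + snd p * ln (real d - 1)
      + 2 * (real l - 1) * ((\<beta> - fst p) * ln (\<beta> - fst p))
      - 2 * real l * ((\<beta> - fst p - snd p / real l) * ln (\<beta> - fst p - snd p / real l))
      - (real l / real d) *
        ((1 - 2 * \<beta> * real d + fst p * real d + snd p * real d / real l) *
         ln (1 - 2 * \<beta> * real d + fst p * real d + snd p * real d / real l)))"
    by (intro continuous_on_add continuous_on_diff continuous_on_minus
        continuous_on_mult_left continuous_on_mult_right c1 c2 c3 c4 c5 c6
        continuous_on_snd continuous_on_id)
  also have "(\<lambda>p.
      - (fst p * ln (fst p)) - real l * (snd p / real l * ln (snd p / real l))
      + (real l - 1) * ((1 - 2 * \<beta> + fst p) * ln (1 - 2 * \<beta> + fst p))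
      + snd p * ln (real d - 1)
      + 2 * (real l - 1) * ((\<beta> - fst p) * ln (\<beta> - fst p))
      - 2 * real l * ((\<beta> - fst p - snd p / real l) * ln (\<beta> - fst p - snd p / real l))
      - (real l / real d) *
        ((1 - 2 * \<beta> * real d + fst p * real d + snd p * real d / real l) *
         ln (1 - 2 * \<beta> * real d + fst p * real d + snd p * real d / real l))) = Psi d l \<beta>"
    using dl by (simp add: Psi_def fun_eq_iff case_prod_beta mult.assoc)
  finally show ?thesis
    using sub continuous_on_subset by blast
qed

end

theory Submission
  imports Defs
begin

text \<open>
  For fixed \<open>\<rho>\<close> the function is strictly concave in \<open>\<theta>\<close>, and its maximum on the
  fibre is at the interior solution of \<open>(d-1) u\<^sup>2 = x w\<close>, where \<open>x = \<theta>/l\<close>,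
  \<open>u = \<beta> - \<rho> - x\<close> and \<open>w = 1 - \<beta> d - u d\<close>. The infinite slope of
  \<open>x ln x\<close> at 0 rules out maximizers with \<open>\<rho> = 0\<close> or \<open>\<rho> = \<beta>\<close>, so
  every maximizer is a critical point. With \<open>s = \<beta> - \<rho>\<close>, criticality in
  \<open>\<rho>\<close> says \<open>u\<^sup>2 = w s t(s)\<close>; eliminating \<open>x\<close> leaves the single equation
  \<open>E(s) = s (1 - (d-1) t(s)) (1 + t(s)) - t(s) (1 - \<beta> d) = 0\<close>. At each of its zeros
  \<open>E' > 0\<close>: for \<open>s < \<beta> - c0\<close> this is equivalent to the hypothesis on
  \<open>G\<close>, and for larger \<open>s\<close> it holds because \<open>s t(s)\<close> is decreasing there.
  Hence there is only one zero, namely \<open>s = \<beta> (1 - \<beta>)\<close>.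
\<close>

section \<open>Tools from one-variable calculus\<close>

text \<open>Right of a zero \<open>p\<close> the function is positive. Before a further zero
  \<open>q\<close> it would have to return to 0, and at the first return \<open>z\<close> it comes
  from positive values, whereas a positive derivative at \<open>z\<close> forces negative values
  just left of \<open>z\<close>.\<close>

lemma at_most_one_zero_if_deriv_pos:
  fixes f f' :: "real \<Rightarrow> real"
  assumes der: "\<And>x. x \<in> {a<..<b} \<Longrightarrow> (f has_real_derivative f' x) (at x)"
    and pos: "\<And>x. x \<in> {a<..<b} \<Longrightarrow> f x = 0 \<Longrightarrow> 0 < f' x"
    and p: "p \<in> {a<..<b}" "f p = 0" and q: "q \<in> {a<..<b}" "f q = 0"
  shows "p = q"
proof -
  have False if pq: "p < q" and p: "p \<in> {a<..<b}" "f p = 0" and q: "q \<in> {a<..<b}" "f q = 0" for p q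
  proof -
    obtain e where e: "0 < e" "\<And>h. 0 < h \<Longrightarrow> h < e \<Longrightarrow> f p < f (p + h)"
      using DERIV_pos_inc_right[OF der[OF p(1)] pos[OF p]] by blast
    define r where "r = p + min (e / 2) ((q - p) / 2)"
    have r: "p < r" "r < q" "r - p < e"
      using e(1) pq by (auto simp: r_def min_def field_simps)
    then have fr: "0 < f r" using e(2)[of "r - p"] p(2) by simp
    define S where "S = {x \<in> {r..q}. f x \<le> 0}"
    have cont: "continuous_on {r..q} f"
      by (rule continuous_at_imp_continuous_on) (use p q r in \<open>auto intro!: DERIV_isCont[OF der]\<close>)
    have "closed S"
      unfolding S_def by (intro continuous_on_closed_Collect_le cont) auto
    moreover have "bounded S"
      by (rule bounded_subset[of "{r..q}"]) (auto simp: S_def)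
    ultimately have "compact S"
      by (simp add: compact_eq_bounded_closed)
    moreover have "q \<in> S" using r q by (auto simp: S_def)
    ultimately obtain z where z: "z \<in> S" "\<And>x. x \<in> S \<Longrightarrow> z \<le> x"
      using compact_attains_inf[of S] by blast
    have zr: "r < z" "z \<le> q" using z(1) fr by (auto simp: S_def order_le_less)
    have before: "0 < f x" if "r \<le> x" "x < z" for x
      using z(2)[of x] that zr by (force simp: S_def)
    have "f z = 0"
    proof (rule ccontr)
      assume "f z \<noteq> 0"
      then have "f z < 0" using z(1) by (auto simp: S_def)
      moreover have "continuous_on {r..z} f" using cont zr continuous_on_subset by fastforce
      ultimately obtain y where y: "r \<le> y" "y \<le> z" "f y = 0"
        using IVT2'[of f z 0 r] fr zr by auto
      then have "y \<noteq> z" using \<open>f z < 0\<close> by auto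
      then show False using before[of y] y by auto
    qed
    moreover have zab: "z \<in> {a<..<b}" using zr p q r by auto
    ultimately obtain e' where e': "0 < e'" "\<And>h. 0 < h \<Longrightarrow> h < e' \<Longrightarrow> f (z - h) < f z"
      using DERIV_pos_inc_left[OF der[OF zab] pos[OF zab]] by blast
    \<comment> \<open>The cap \<open>z - r\<close> keeps \<open>z - h\<close> in
      \<open>{r..<z}\<close>, where \<open>f\<close> is positive by \<open>before\<close>.\<close>
    define h where "h = min (e' / 2) (z - r)"
    have "f (z - h) < 0" "0 < f (z - h)"
      using e'(2)[of h] e'(1) zr \<open>f z = 0\<close> before[of "z - h"] by (auto simp: h_def min_def)
    then show False by simp
  qed
  from this[of p q] this[of q p] p q show ?thesis by (meson linorder_cases)
qed

text \<open>The difference quotient of \<open>\<phi>\<close> stays bounded near 0 while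
  \<open>- c * ln s\<close> tends to infinity. This excludes maximizers at points where an entropy
  term degenerates.\<close>

lemma exceeds_if_entropy_term:
  fixes \<phi> :: "real \<Rightarrow> real"
  assumes der: "(\<phi> has_real_derivative D) (at 0)" and c: "0 < c" and e: "0 < e"
  shows "\<exists>s. 0 < s \<and> s < e \<and> \<phi> 0 < \<phi> s - c * (s * ln s)"
proof -
  have "((\<lambda>s. (\<phi> s - \<phi> 0) / s) \<longlongrightarrow> D) (at_right 0)"
    using der unfolding has_field_derivative_iff
    by (auto intro: tendsto_mono at_le)
  moreover have "filterlim (\<lambda>s. - c * ln s) at_top (at_right 0)"
    using c by real_asymp
  ultimately have "filterlim (\<lambda>s. (\<phi> s - \<phi> 0) / s + (- c * ln s)) at_top (at_right 0)"
    by (rule filterlim_tendsto_add_at_top)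
  then have "\<forall>\<^sub>F s in at_right 0. 0 < (\<phi> s - \<phi> 0) / s + (- c * ln s)"
    unfolding filterlim_at_top_dense by blast
  moreover have "\<forall>\<^sub>F s in at_right (0::real). s \<in> {0<..<e}"
    using e eventually_at_right_real by blast
  ultimately have "\<forall>\<^sub>F s in at_right 0. s \<in> {0<..<e} \<and> 0 < (\<phi> s - \<phi> 0) / s + (- c * ln s)"
    by (simp add: eventually_conj_iff)
  then obtain s where s: "0 < s" "s < e" "0 < (\<phi> s - \<phi> 0) / s + (- c * ln s)"
    by (metis (no_types, lifting) eventually_happens' greaterThanLessThan_iff trivial_limit_at_right_real)
  have "0 < s * ((\<phi> s - \<phi> 0) / s + (- c * ln s))" using s by simp
  also have "\<dots> = \<phi> s - c * (s * ln s) - \<phi> 0" using s by (simp add: field_simps)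
  finally show ?thesis using s by auto
qed

text \<open>Strict convexity of \<open>x ln x\<close>, from \<open>ln y \<le> y - 1\<close> at
  \<open>y = b / a\<close>. For \<open>a = 0\<close> the left side is \<open>- b\<close>.\<close>

lemma x_ln_x_ge_tangent:
  fixes a b :: real
  assumes "0 \<le> a" "0 < b"
  shows "a * ln b + a - b \<le> a * ln a"
    and "a \<noteq> b \<Longrightarrow> a * ln b + a - b < a * ln a"
proof -
  have strict: "a * ln b + a - b < a * ln a" if "a \<noteq> b"
  proof (cases "a = 0")
    case False
    then have a: "0 < a" using assms by simp
    have "ln (b / a) < b / a - 1"
      using ln_le_minus_one[of "b / a"] ln_eq_minus_one[of "b / a"] a assms that
      by (auto simp: less_le)
    then have "a * ln (b / a) < a * (b / a - 1)" using a by simp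
    then show ?thesis using a assms by (simp add: ln_div algebra_simps)
  qed (use assms in auto)
  then show "a \<noteq> b \<Longrightarrow> a * ln b + a - b < a * ln a" .
  show "a * ln b + a - b \<le> a * ln a" using strict by (cases "a = b") auto
qed

section \<open>The problem in the coordinates \<open>(\<rho>, x)\<close> with
  \<open>x = \<theta> / l\<close>\<close>

locale region =
  fixes d l :: nat and \<beta> :: real
  assumes d2: "2 \<le> d" and l2: "2 \<le> l" and \<beta>_pos: "0 < \<beta>" and \<beta>_less: "\<beta> < 1 / real d"
begin

abbreviation "D \<equiv> real d"
abbreviation "L \<equiv> real l"

lemma real_bounds: "2 \<le> D" "2 \<le> L" "\<beta> * D < 1" "2 * \<beta> < 1"
proof -
  show "2 \<le> D" "2 \<le> L" using d2 l2 by auto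
  show *: "\<beta> * D < 1" using \<beta>_less d2 by (simp add: field_simps)
  have "\<beta> * 2 \<le> \<beta> * D" using d2 \<beta>_pos by (intro mult_left_mono) auto
  with * show "2 * \<beta> < 1" by linarith
qed

definition W :: "real \<Rightarrow> real \<Rightarrow> real" where
  "W \<rho> x = 1 - 2 * \<beta> * D + \<rho> * D + x * D"

text \<open>The grouping into multiples of \<open>y * ln y\<close> lets tangent bounds, derivatives
  and continuity at 0 be applied term by term.\<close>

definition P :: "real \<Rightarrow> real \<Rightarrow> real" where
  "P \<rho> x = - (\<rho> * ln \<rho>) - L * (x * ln x) + (L - 1) * ((1 - 2 * \<beta> + \<rho>) * ln (1 - 2 * \<beta> + \<rho>))
     + L * (x * ln (D - 1)) + 2 * (L - 1) * ((\<beta> - \<rho>) * ln (\<beta> - \<rho>))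
     - 2 * L * ((\<beta> - \<rho> - x) * ln (\<beta> - \<rho> - x)) - L / D * (W \<rho> x * ln (W \<rho> x))"

lemma Psi_eq_P: "Psi d l \<beta> (\<rho>, L * x) = P \<rho> x"
  using real_bounds by (simp add: Psi_def P_def W_def algebra_simps)

text \<open>A compact set whose image under \<open>x \<mapsto> L * x\<close> in the second
  coordinate contains the closure of \<open>Reg\<close>. The condition on \<open>W\<close> is the
  lower bound \<open>2 * L * \<beta> - L * \<rho> - L / D \<le> L * x\<close>.\<close>

definition C :: "(real \<times> real) set" where
  "C = {(\<rho>, x). 0 \<le> \<rho> \<and> \<rho> \<le> \<beta> \<and> 0 \<le> x \<and> x \<le> \<beta> - \<rho> \<and> 0 \<le> W \<rho> x}"

section \<open>Maximization along a fibre of constant \<open>\<rho>\<close>\<close>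

text \<open>Each entropy term that depends on \<open>x\<close> is bounded by its tangent at
  \<open>z\<close>. The resulting linear bound has slope 0 by the logarithm of \<open>crit\<close>;
  the tangent for \<open>x * ln x\<close> is strict.\<close>

lemma fibre_max:
  assumes z: "0 < z" "z < \<beta> - \<rho>" "0 < W \<rho> z"
    and crit: "(D - 1) * (\<beta> - \<rho> - z)\<^sup>2 = z * W \<rho> z"
    and x: "(\<rho>, x) \<in> C" "x \<noteq> z"
  shows "P \<rho> x < P \<rho> z"
proof -
  let ?u = "\<beta> - \<rho> - x" and ?v = "\<beta> - \<rho> - z"
  have crit_ln: "ln (D - 1) + 2 * ln ?v = ln z + ln (W \<rho> z)"
    using arg_cong[OF crit, of ln] z real_bounds by (simp add: ln_mult ln_realpow)
  have 1: "x * ln z + x - z < x * ln x"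
    using x_ln_x_ge_tangent(2)[of x z] x z by (auto simp: C_def)
  have 2: "?u * ln ?v + ?u - ?v \<le> ?u * ln ?u"
    using x_ln_x_ge_tangent(1)[of ?u ?v] x z by (auto simp: C_def)
  have 3: "W \<rho> x * ln (W \<rho> z) + W \<rho> x - W \<rho> z \<le> W \<rho> x * ln (W \<rho> x)"
    using x_ln_x_ge_tangent(1)[of "W \<rho> x" "W \<rho> z"] x z by (auto simp: C_def)
  have 4: "W \<rho> x = W \<rho> z + D * (x - z)" by (simp add: W_def algebra_simps)
  define A B F where "A = ln z" and "B = ln ?v" and "F = ln (W \<rho> z)"
  have "P \<rho> x - P \<rho> z = L * (z * ln z - x * ln x + (x - z) * ln (D - 1)) +
      2 * L * (?v * ln ?v - ?u * ln ?u) + L / D * (W \<rho> z * ln (W \<rho> z) - W \<rho> x * ln (W \<rho> x))"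
    by (simp add: P_def algebra_simps)
  also have "\<dots> < L * (z * A - (x * A + x - z) + (x - z) * ln (D - 1)) +
      2 * L * (?v * B - (?u * B + ?u - ?v)) +
      L / D * (W \<rho> z * F - (W \<rho> x * F + W \<rho> x - W \<rho> z))"
    unfolding A_def B_def F_def
  proof (intro add_less_le_mono)
    show "L * (z * ln z - x * ln x + (x - z) * ln (D - 1))
        < L * (z * ln z - (x * ln z + x - z) + (x - z) * ln (D - 1))"
      using 1 real_bounds by (intro mult_strict_left_mono) linarith+
    show "2 * L * (?v * ln ?v - ?u * ln ?u) \<le> 2 * L * (?v * ln ?v - (?u * ln ?v + ?u - ?v))"
      using 2 by (intro mult_left_mono diff_left_mono) auto
    show "L / D * (W \<rho> z * ln (W \<rho> z) - W \<rho> x * ln (W \<rho> x))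
        \<le> L / D * (W \<rho> z * ln (W \<rho> z) - (W \<rho> x * ln (W \<rho> z) + W \<rho> x - W \<rho> z))"
      using 3 by (intro mult_left_mono diff_left_mono) auto
  qed
  \<comment> \<open>The parts of the tangents free of logarithms are -1, +2 and -1 times
    \<open>L * (x - z)\<close> and cancel.\<close>
  also have "\<dots> = L * (x - z) * (ln (D - 1) + 2 * B - A - F)"
    using real_bounds unfolding 4 by (simp add: field_simps)
  also have "\<dots> = 0" using crit_ln by (simp add: A_def B_def F_def)
  finally show ?thesis by simp
qed

lemma fibre_crit_exists:
  assumes "\<rho> < \<beta>"
  shows "\<exists>z>0. z < \<beta> - \<rho> \<and> 0 < W \<rho> z \<and> (D - 1) * (\<beta> - \<rho> - z)\<^sup>2 = z * W \<rho> z"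
proof -
  let ?s = "\<beta> - \<rho>"
  \<comment> \<open>With \<open>u = ?s - z\<close>, the critical equation is \<open>g u = 0\<close>.
    At \<open>u = m\<close> the first of the two factors of the product in \<open>g\<close>
    vanishes, so \<open>g\<close> changes sign on \<open>{0..m}\<close>, and any root strictly
    inside keeps \<open>z\<close> and \<open>W\<close> positive.\<close>
  define m where "m = min ?s ((1 - \<beta> * D) / D)"
  define g where "g u = (D - 1) * u\<^sup>2 - (?s - u) * (1 - \<beta> * D - u * D)" for u
  have m: "0 < m" "m \<le> ?s" "m * D \<le> 1 - \<beta> * D"
    using assms real_bounds by (auto simp: m_def min_def field_simps)
  have "(?s - m) * (1 - \<beta> * D - m * D) = 0"
    using real_bounds by (auto simp: m_def min_def)
  moreover have "0 < (D - 1) * m\<^sup>2" using real_bounds m by simp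
  ultimately have gm: "0 < g m" by (simp only: g_def)
  have g0: "g 0 < 0" using assms real_bounds by (simp add: g_def)
  have "continuous_on {0..m} g"
    unfolding g_def by (intro continuous_intros)
  then obtain u where u: "0 \<le> u" "u \<le> m" "g u = 0"
    using IVT'[of g 0 0 m] gm g0 m by auto
  have "u \<noteq> 0" "u \<noteq> m" using u gm g0 by auto
  then have u': "0 < u" "u < m" using u by auto
  have "u * D < m * D" using u' real_bounds by simp
  then have "0 < 1 - \<beta> * D - u * D" using m by linarith
  moreover have "W \<rho> (?s - u) = 1 - \<beta> * D - u * D" by (simp add: W_def algebra_simps)
  ultimately show ?thesis
    using u u' m by (intro exI[of _ "?s - u"]) (auto simp: g_def)
qed

section \<open>Exclusion of the edges \<open>\<rho> = 0\<close> and
  \<open>\<rho> = \<beta>\<close>\<close>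

text \<open>At fixed interior \<open>z\<close> only \<open>\<rho> * ln \<rho>\<close> degenerates at
  \<open>\<rho> = 0\<close>. Adding it back leaves a function differentiable at 0.\<close>

lemma rho_zero_not_max:
  assumes z: "0 < z" "z < \<beta>" "0 < W 0 z"
  shows "\<exists>\<rho>. (\<rho>, z) \<in> C \<and> P 0 z < P \<rho> z"
proof -
  define \<phi> where "\<phi> \<rho> = P \<rho> z + 1 * (\<rho> * ln \<rho>)" for \<rho>
  have \<phi>: "\<phi> = (\<lambda>\<rho>. - L * (z * ln z) + (L - 1) * ((1 - 2 * \<beta> + \<rho>) * ln (1 - 2 * \<beta> + \<rho>))
     + L * (z * ln (D - 1)) + 2 * (L - 1) * ((\<beta> - \<rho>) * ln (\<beta> - \<rho>))
     - 2 * L * ((\<beta> - \<rho> - z) * ln (\<beta> - \<rho> - z)) 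
     - L / D * ((1 - 2 * \<beta> * D + \<rho> * D + z * D) * ln (1 - 2 * \<beta> * D + \<rho> * D + z * D)))"
    by (simp add: \<phi>_def P_def W_def fun_eq_iff)
  have "\<exists>E. (\<phi> has_real_derivative E) (at 0)"
    unfolding \<phi> using z real_bounds \<beta>_pos
    by (intro exI) (auto intro!: derivative_eq_intros simp: W_def)
  then obtain E where "(\<phi> has_real_derivative E) (at 0)" ..
  from exceeds_if_entropy_term[OF this, of 1 "\<beta> - z"] z
  obtain r where r: "0 < r" "r < \<beta> - z" "\<phi> 0 < \<phi> r - 1 * (r * ln r)" by auto
  have "0 \<le> r * D" using r by simp
  then have "0 \<le> W r z" using z by (simp add: W_def)
  with r z show ?thesis by (intro exI[of _ r]) (auto simp: \<phi>_def C_def)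
qed

lemma rho_beta_not_max: "\<exists>\<rho>. (\<rho>, 0) \<in> C \<and> P \<beta> 0 < P \<rho> 0"
proof -
  \<comment> \<open>For \<open>x = 0\<close> two terms degenerate together; their coefficients
    \<open>2 * (L - 1)\<close> and \<open>- 2 * L\<close> sum to -2.\<close>
  define \<phi> where "\<phi> s = P (\<beta> - s) 0 + 2 * (s * ln s)" for s
  have \<phi>: "\<phi> = (\<lambda>s. - ((\<beta> - s) * ln (\<beta> - s)) + (L - 1) * ((1 - \<beta> - s) * ln (1 - \<beta> - s))
     - L / D * ((1 - \<beta> * D - s * D) * ln (1 - \<beta> * D - s * D)))"
    by (simp add: \<phi>_def P_def W_def fun_eq_iff algebra_simps)
  have "\<exists>E. (\<phi> has_real_derivative E) (at 0)"
    unfolding \<phi> using real_bounds \<beta>_pos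
    by (intro exI) (auto intro!: derivative_eq_intros)
  then obtain E where E: "(\<phi> has_real_derivative E) (at 0)" ..
  have "0 < min \<beta> ((1 - \<beta> * D) / D)" using real_bounds \<beta>_pos by simp
  from exceeds_if_entropy_term[OF E, of 2, OF _ this]
  obtain s where s: "0 < s" "s < \<beta>" "s < (1 - \<beta> * D) / D" "\<phi> 0 < \<phi> s - 2 * (s * ln s)" by auto
  have "s * D < 1 - \<beta> * D" using s real_bounds by (simp add: field_simps)
  then have "0 \<le> W (\<beta> - s) 0" by (simp add: W_def algebra_simps)
  with s show ?thesis by (intro exI[of _ "\<beta> - s"]) (auto simp: \<phi>_def C_def)
qed

section \<open>Criticality in \<open>\<rho>\<close> and reduction to one equation\<close>

lemma P_deriv_rho:
  assumes "0 < \<rho>" "\<rho> < \<beta>" "0 < z" "z < \<beta> - \<rho>" "0 < W \<rho> z"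
  shows "((\<lambda>r. P r z) has_real_derivative
    (- ln \<rho> + (L - 1) * ln (1 - 2 * \<beta> + \<rho>) - 2 * (L - 1) * ln (\<beta> - \<rho>)
     + 2 * L * ln (\<beta> - \<rho> - z) - L * ln (W \<rho> z))) (at \<rho>)"
proof -
  have xlx: "((\<lambda>r. f r * ln (f r)) has_real_derivative f' * (ln (f \<rho>) + 1)) (at \<rho>)"
    if "(f has_real_derivative f') (at \<rho>)" "0 < f \<rho>" for f f'
    using that by (auto intro!: derivative_eq_intros simp: algebra_simps)
  have "((\<lambda>r. P r z) has_real_derivative
      - (1 * (ln \<rho> + 1)) - 0 + (L - 1) * (1 * (ln (1 - 2 * \<beta> + \<rho>) + 1)) + 0
      + 2 * (L - 1) * (- 1 * (ln (\<beta> - \<rho>) + 1)) - 2 * L * (- 1 * (ln (\<beta> - \<rho> - z) + 1))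
      - L / D * (D * (ln (W \<rho> z) + 1))) (at \<rho>)"
    unfolding P_def
    by (intro DERIV_add DERIV_diff DERIV_minus DERIV_const DERIV_cmult xlx)
      (use assms real_bounds in \<open>auto simp: W_def intro!: derivative_eq_intros\<close>)
  moreover have "L / D * (D * (ln (W \<rho> z) + 1)) = L * ln (W \<rho> z) + L"
    using real_bounds by (simp add: distrib_left)
  \<comment> \<open>The constants from differentiating \<open>y * ln y\<close> cancel:
    \<open>- 1 + (L - 1) - 2 * (L - 1) + 2 * L - L = 0\<close>.\<close>
  ultimately show ?thesis using d2 by (simp add: algebra_simps)
qed

definition E :: "real \<Rightarrow> real" where
  "E s = s * (1 - (D - 1) * t_fun l \<beta> s) * (1 + t_fun l \<beta> s) - t_fun l \<beta> s * (1 - \<beta> * D)"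

lemma ln_t_fun:
  assumes "0 < s" "s < \<beta>"
  shows "L * ln (t_fun l \<beta> s) = ln (\<beta> - s) + (L - 2) * ln s - (L - 1) * ln (1 - \<beta> - s)"
  using assms real_bounds
  by (simp add: t_fun_def ln_mult ln_div ln_powr field_simps)

lemma t_fun_pos: "0 < s \<Longrightarrow> s < \<beta> \<Longrightarrow> 0 < t_fun l \<beta> s"
  using real_bounds by (simp add: t_fun_def)

text \<open>By \<open>ln_t_fun\<close>, \<open>crit\<rho>\<close> is the logarithm of
  \<open>t * w * s = u\<^sup>2\<close>. Comparison with \<open>crit\<close> gives
  \<open>z = (D - 1) * s * t\<close>, so \<open>u\<close> and \<open>w\<close> become functions of
  \<open>s\<close>.\<close>

lemma crit_imp_E_zero:
  assumes "0 < \<rho>" "\<rho> < \<beta>" "0 < z" "z < \<beta> - \<rho>" "0 < W \<rho> z"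
    and crit: "(D - 1) * (\<beta> - \<rho> - z)\<^sup>2 = z * W \<rho> z"
    and crit\<rho>: "- ln \<rho> + (L - 1) * ln (1 - 2 * \<beta> + \<rho>) - 2 * (L - 1) * ln (\<beta> - \<rho>)
     + 2 * L * ln (\<beta> - \<rho> - z) - L * ln (W \<rho> z) = 0"
  shows "z = (D - 1) * (\<beta> - \<rho>) * t_fun l \<beta> (\<beta> - \<rho>)" and "E (\<beta> - \<rho>) = 0"
proof -
  define s u w t where "s = \<beta> - \<rho>" and "u = \<beta> - \<rho> - z" and "w = W \<rho> z" and "t = t_fun l \<beta> s"
  have pos: "0 < s" "0 < u" "0 < w" "0 < t" "s < \<beta>"
    using assms by (auto simp: s_def u_def w_def t_def intro!: t_fun_pos)
  have "L * ln t = L * (2 * ln u - ln w - ln s)"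
    using crit\<rho> ln_t_fun[of s] pos by (simp add: s_def u_def w_def t_def algebra_simps)
  then have "ln t = 2 * ln u - ln w - ln s" using real_bounds by simp
  also have "\<dots> = ln (u\<^sup>2 / (w * s))"
    using pos by (simp add: ln_div ln_mult ln_realpow)
  finally have "t = u\<^sup>2 / (w * s)" using pos by simp
  then have t: "t * w * s = u\<^sup>2" using pos by (simp add: field_simps)
  have "z * w = (D - 1) * (t * w * s)" using crit unfolding t by (simp add: u_def w_def)
  then have "z * w = (D - 1) * s * t * w" by (simp only: ac_simps)
  then have z: "z = (D - 1) * s * t" using pos by simp
  then show "z = (D - 1) * (\<beta> - \<rho>) * t_fun l \<beta> (\<beta> - \<rho>)" by (simp add: s_def t_def)
  have u: "u = s * (1 - (D - 1) * t)" using z by (simp add: u_def s_def algebra_simps)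
  have w: "w = 1 - \<beta> * D - u * D" by (simp add: w_def W_def u_def algebra_simps)
  have "s * (t * (1 - \<beta> * D - u * D) - s * (1 - (D - 1) * t)\<^sup>2) = 0"
    using t unfolding w by (simp add: u power2_eq_square algebra_simps)
  then have "t * (1 - \<beta> * D - u * D) - s * (1 - (D - 1) * t)\<^sup>2 = 0" using pos by simp
  \<comment> \<open>One factor \<open>1 - (D - 1) * t\<close> splits off, and the other combines
    with \<open>D * t\<close> to \<open>1 + t\<close>.\<close>
  then show "E (\<beta> - \<rho>) = 0"
    unfolding E_def s_def[symmetric] t_def[symmetric] u
    by (simp add: power2_eq_square algebra_simps)
qed

section \<open>The derivative of \<open>E\<close> at its zeros\<close>

text \<open>Logarithmic differentiation: on \<open>(0, \<beta>)\<close> the function equals the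
  exponential \<open>g\<close>. In the numerator the terms in \<open>s\<^sup>2\<close>
  cancel.\<close>

lemma t_fun_deriv:
  assumes s: "0 < s" "s < \<beta>"
  shows "(t_fun l \<beta> has_real_derivative
    t_fun l \<beta> s * ((\<beta> - s) * (L - 1 - L * \<beta>) - \<beta> * (1 - 2 * \<beta>)) / (L * ((\<beta> - s) * (1 - \<beta> - s)) * s)) (at s)"
proof -
  define g where "g x = exp ((ln (\<beta> - x) + (L - 2) * ln x - (L - 1) * ln (1 - \<beta> - x)) / L)" for x
  have g: "t_fun l \<beta> x = g x" if "x \<in> {0<..<\<beta>}" for x
  proof -
    have "ln (t_fun l \<beta> x) = (ln (\<beta> - x) + (L - 2) * ln x - (L - 1) * ln (1 - \<beta> - x)) / L"
      using ln_t_fun[of x] that real_bounds by (simp add: eq_divide_eq mult.commute)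
    then show ?thesis using t_fun_pos[of x] that exp_ln[of "t_fun l \<beta> x"] by (simp add: g_def)
  qed
  have pos: "0 < \<beta> - s" "0 < 1 - \<beta> - s" "0 < s" using s real_bounds by auto
  have "(g has_real_derivative
      g s * ((- 1 / (\<beta> - s) + (L - 2) / s + (L - 1) / (1 - \<beta> - s)) / L)) (at s)"
    unfolding g_def using pos real_bounds by (auto intro!: derivative_eq_intros)
  also have "(- 1 / (\<beta> - s) + (L - 2) / s + (L - 1) / (1 - \<beta> - s)) / L =
      ((\<beta> - s) * (L - 1 - L * \<beta>) - \<beta> * (1 - 2 * \<beta>)) / (L * ((\<beta> - s) * (1 - \<beta> - s)) * s)"
  proof -
    have "- 1 / (\<beta> - s) + (L - 2) / s + (L - 1) / (1 - \<beta> - s) =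
        (- s * (1 - \<beta> - s) + (L - 2) * (\<beta> - s) * (1 - \<beta> - s) + (L - 1) * (\<beta> - s) * s)
        / ((\<beta> - s) * (1 - \<beta> - s) * s)"
      using pos by (simp add: divide_simps) (simp add: algebra_simps)
    also have "- s * (1 - \<beta> - s) + (L - 2) * (\<beta> - s) * (1 - \<beta> - s) + (L - 1) * (\<beta> - s) * s
        = (\<beta> - s) * (L - 1 - L * \<beta>) - \<beta> * (1 - 2 * \<beta>)"
      by (simp add: algebra_simps)
    finally show ?thesis by (simp add: ac_simps)
  qed
  finally have "(g has_real_derivative t_fun l \<beta> s *
    (((\<beta> - s) * (L - 1 - L * \<beta>) - \<beta> * (1 - 2 * \<beta>)) / (L * ((\<beta> - s) * (1 - \<beta> - s)) * s))) (at s)"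
    using g[of s] s by simp
  then show ?thesis
    using has_field_derivative_transform_within_open[of g _ s "{0<..<\<beta>}" "t_fun l \<beta>"] g s by simp
qed

definition E' :: "real \<Rightarrow> real" where
  "E' s = (let t = t_fun l \<beta> s;
      t' = t * ((\<beta> - s) * (L - 1 - L * \<beta>) - \<beta> * (1 - 2 * \<beta>)) / (L * ((\<beta> - s) * (1 - \<beta> - s)) * s)
    in (1 - (D - 2) * t - (D - 1) * t\<^sup>2) - t' * ((D - 2) * s + 2 * (D - 1) * s * t + (1 - \<beta> * D)))"

lemma E_deriv:
  assumes "0 < s" "s < \<beta>"
  shows "(E has_real_derivative E' s) (at s)"
proof -
  define t' where "t' = t_fun l \<beta> s * ((\<beta> - s) * (L - 1 - L * \<beta>) - \<beta> * (1 - 2 * \<beta>)) /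
    (L * ((\<beta> - s) * (1 - \<beta> - s)) * s)"
  have "(t_fun l \<beta> has_real_derivative t') (at s)"
    using t_fun_deriv[OF assms] by (simp add: t'_def)
  then show ?thesis
    unfolding E_def[abs_def] E'_def Let_def t'_def[symmetric]
    by (auto intro!: derivative_eq_intros simp: power2_eq_square algebra_simps)
qed

text \<open>
  The quadratic has the sign of the derivative of \<open>s t(s)\<close> at \<open>s = \<beta> - \<rho>\<close>,
  and \<open>c0\<close> is its positive root.
\<close>
lemma quadratic_le_c0:
  assumes "0 \<le> \<rho>" "\<rho> \<le> c0 l \<beta>"
  shows "L * \<rho>\<^sup>2 - (3 * \<beta> * L - 2 * L + 1) * \<rho> - \<beta> * (1 - 2 * \<beta>) \<le> 0"
proof -
  define b where "b = 3 * \<beta> * L - 2 * L + 1"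
  have "9 * \<beta>\<^sup>2 * L\<^sup>2 - 8 * \<beta>\<^sup>2 * L - 12 * \<beta> * L\<^sup>2 + 10 * \<beta> * L + 4 * L\<^sup>2 - 4 * L + 1
      = b\<^sup>2 + 4 * L * (\<beta> * (1 - 2 * \<beta>))"
    by (simp add: b_def power2_eq_square algebra_simps)
  then have "c0 l \<beta> = (b + sqrt (b\<^sup>2 + 4 * L * (\<beta> * (1 - 2 * \<beta>)))) / (2 * L)"
    by (simp add: c0_def b_def Let_def)
  then have "2 * L * c0 l \<beta> = b + sqrt (b\<^sup>2 + 4 * L * (\<beta> * (1 - 2 * \<beta>)))"
    using real_bounds by simp
  moreover have "2 * L * \<rho> \<le> 2 * L * c0 l \<beta>" using assms by (intro mult_left_mono) auto
  ultimately have "2 * L * \<rho> - b \<le> sqrt (b\<^sup>2 + 4 * L * (\<beta> * (1 - 2 * \<beta>)))"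
    by linarith
  \<comment> \<open>Squaring the inequality needs this sign. From \<open>2 * \<beta> < 1\<close>
    follows \<open>b \<le> 1 - L / 2\<close>, which is at most 0.\<close>
  moreover have "0 \<le> 2 * L * \<rho> - b"
  proof -
    have "2 * \<beta> * L \<le> 1 * L" using real_bounds by (intro mult_right_mono) auto
    then have "b \<le> 0" using real_bounds unfolding b_def by linarith
    moreover have "0 \<le> 2 * L * \<rho>" using assms by simp
    ultimately show ?thesis by linarith
  qed
  moreover have "0 \<le> b\<^sup>2 + 4 * L * (\<beta> * (1 - 2 * \<beta>))"
    using real_bounds \<beta>_pos by simp
  ultimately have "(2 * L * \<rho> - b)\<^sup>2 \<le> b\<^sup>2 + 4 * L * (\<beta> * (1 - 2 * \<beta>))"
    by (metis power_mono real_sqrt_pow2)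
  then have "4 * L * (L * \<rho>\<^sup>2 - b * \<rho> - \<beta> * (1 - 2 * \<beta>)) \<le> 4 * L * 0"
    by (simp add: power2_eq_square algebra_simps)
  then have "L * \<rho>\<^sup>2 - b * \<rho> - \<beta> * (1 - 2 * \<beta>) \<le> 0"
    using real_bounds by (subst (asm) mult_le_cancel_left_pos) auto
  then show ?thesis by (simp add: b_def)
qed

text \<open>At a zero of \<open>E\<close>, \<open>K\<close> is the positive multiple
  \<open>s * (L * R)\<close> of \<open>E' s\<close>. Here \<open>N / (L * R * s)\<close> is the
  logarithmic derivative of \<open>t_fun\<close>. Left of \<open>\<beta> - c0 l \<beta>\<close> the
  sign of \<open>K\<close> comes from \<open>G_fun\<close>; from there on \<open>N \<le> 0\<close>
  suffices.\<close>

lemma E'_pos_at_zero: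
  assumes G: "\<And>s. 0 < s \<Longrightarrow> s < \<beta> - c0 l \<beta> \<Longrightarrow> G_fun d l \<beta> s > 0"
    and s: "0 < s" "s < \<beta>" and zero: "E s = 0"
  shows "0 < E' s"
proof -
  define t N R where "t = t_fun l \<beta> s" and
    "N = (\<beta> - s) * (L - 1 - L * \<beta>) - \<beta> * (1 - 2 * \<beta>)" and
    "R = (\<beta> - s) * (1 - \<beta> - s)"
  define K where "K = L * R * t * (1 - \<beta> * D) - N * (s + (D - 1) * s * t\<^sup>2)"
  have pos: "0 < t" "0 < R" using s real_bounds by (auto simp: t_def R_def intro!: t_fun_pos)
  have E0: "s * (1 - (D - 1) * t) * (1 + t) = t * (1 - \<beta> * D)"
    using zero by (simp add: E_def t_def)
  have "0 < K"
  proof (cases "s < \<beta> - c0 l \<beta>")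
    case True
    define g where "g = G_fun d l \<beta> s"
    have "0 < g" unfolding g_def using G s True by blast
    \<comment> \<open>\<open>G\<close> is \<open>K\<close> reduced modulo \<open>E\<close>, up to the factor \<open>s (1 + t) / (1 - \<beta> d)\<close>.\<close>
    have "K * (1 - \<beta> * D) = s * (1 + t) * g
        + (N * (1 - \<beta> * D) - ((D + L - D * L) * s\<^sup>2 + 2 * \<beta> * (1 - \<beta> * D) * (1 - \<beta>) * (L - 1)
           + s * (\<beta> * L - 3 * \<beta> * D - 2 * L + 2 * \<beta>\<^sup>2 * D + 3 * \<beta> * D * L - 2 * \<beta>\<^sup>2 * D * L + 1)))
          * (s * (1 - (D - 1) * t) * (1 + t) - t * (1 - \<beta> * D))"
      unfolding K_def g_def G_fun_def Let_def t_def[symmetric] N_def R_def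
      by (simp add: power2_eq_square algebra_simps)
    also have "\<dots> = s * (1 + t) * g" using E0 by simp
    finally have "0 < K * (1 - \<beta> * D)" using \<open>0 < g\<close> pos s by simp
    then show ?thesis using real_bounds by (simp add: zero_less_mult_iff)
  next
    case False
    \<comment> \<open>In terms of \<open>\<rho> = \<beta> - s\<close>, \<open>N + L * R\<close> is
      exactly the quadratic of \<open>quadratic_le_c0\<close>.\<close>
    then have "N + L * R \<le> 0"
      using quadratic_le_c0[of "\<beta> - s"] s
      by (simp add: N_def R_def power2_eq_square algebra_simps)
    then have "N \<le> 0" using pos real_bounds by (smt (verit) mult_pos_pos)
    moreover have "0 \<le> s + (D - 1) * s * t\<^sup>2" using s real_bounds by simp
    ultimately have "N * (s + (D - 1) * s * t\<^sup>2) \<le> 0" by (simp add: mult_nonpos_nonneg)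
    moreover have "0 < L * R * t * (1 - \<beta> * D)" using pos real_bounds by simp
    ultimately show ?thesis by (simp add: K_def)
  qed
  moreover have "s * (L * R) * E' s = K"
  proof -
    have "s * (L * R) * E' s = (L * R) * (s * (1 - (D - 2) * t - (D - 1) * t\<^sup>2))
        - N * (t * ((D - 2) * s + 2 * (D - 1) * s * t + (1 - \<beta> * D)))"
      unfolding E'_def Let_def t_def[symmetric] N_def[symmetric] R_def[symmetric]
      using s pos real_bounds by (simp add: field_simps)
    \<comment> \<open>Here and in the next rewriting \<open>E s = 0\<close> is used, with
      \<open>(1 - (D - 1) * t) * (1 + t)\<close> expanded.\<close>
    also have "s * (1 - (D - 2) * t - (D - 1) * t\<^sup>2) = t * (1 - \<beta> * D)"
      using E0 by (simp add: power2_eq_square algebra_simps)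
    also have "t * ((D - 2) * s + 2 * (D - 1) * s * t + (1 - \<beta> * D)) = s + (D - 1) * s * t\<^sup>2"
      using E0 by (simp add: power2_eq_square algebra_simps)
    finally show ?thesis by (simp add: K_def)
  qed
  moreover have "0 < s * (L * R)" using s pos real_bounds by simp
  ultimately show ?thesis by (metis zero_less_mult_pos)
qed

section \<open>Values at the candidate point\<close>

text \<open>All three bases factor into powers of \<open>\<beta>\<close> and
  \<open>1 - \<beta>\<close>, whose total exponents are 1 and -1.\<close>

lemma t_fun_opt: "t_fun l \<beta> (\<beta> * (1 - \<beta>)) = \<beta> / (1 - \<beta>)"
proof -
  let ?s = "\<beta> * (1 - \<beta>)"
  have s: "0 < ?s" "?s < \<beta>" using \<beta>_pos real_bounds by auto
  have 1: "\<beta> - ?s = \<beta>\<^sup>2" "1 - \<beta> - ?s = (1 - \<beta>)\<^sup>2"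
    by (auto simp: power2_eq_square algebra_simps)
  have 2: "ln (\<beta>\<^sup>2) = 2 * ln \<beta>" "ln ((1 - \<beta>)\<^sup>2) = 2 * ln (1 - \<beta>)"
    "ln ?s = ln \<beta> + ln (1 - \<beta>)"
    using real_bounds \<beta>_pos by (auto simp: ln_mult ln_realpow)
  have "L * ln (t_fun l \<beta> ?s) = L * (ln \<beta> - ln (1 - \<beta>))"
    using ln_t_fun[OF s] unfolding 1 2 by (simp add: algebra_simps)
  then have "ln (t_fun l \<beta> ?s) = ln (\<beta> / (1 - \<beta>))"
    using \<beta>_pos real_bounds by (simp add: ln_div)
  then show ?thesis using t_fun_pos[OF s] \<beta>_pos real_bounds by simp
qed

lemma E_opt: "E (\<beta> * (1 - \<beta>)) = 0"
proof -
  have 1: "\<beta> * (1 - \<beta>) * (1 - (D - 1) * (\<beta> / (1 - \<beta>))) = \<beta> * (1 - \<beta> * D)"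
    "1 + \<beta> / (1 - \<beta>) = 1 / (1 - \<beta>)"
    using real_bounds by (simp_all add: field_simps)
  show ?thesis unfolding E_def t_fun_opt 1 by simp
qed

text \<open>Every logarithm splits into those of \<open>\<beta>\<close>, \<open>1 - \<beta>\<close>,
  \<open>1 - \<beta> * D\<close> and \<open>D - 1\<close>; the contributions of
  \<open>ln (D - 1)\<close> cancel.\<close>

lemma P_opt: "P (\<beta>\<^sup>2) ((D - 1) * \<beta>\<^sup>2) = 2 * Phi d l \<beta>"
proof -
  have 1: "1 - 2 * \<beta> + \<beta>\<^sup>2 = (1 - \<beta>)\<^sup>2" "\<beta> - \<beta>\<^sup>2 = \<beta> * (1 - \<beta>)"
    "\<beta> * (1 - \<beta>) - (D - 1) * \<beta>\<^sup>2 = \<beta> * (1 - \<beta> * D)"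
    "W (\<beta>\<^sup>2) ((D - 1) * \<beta>\<^sup>2) = (1 - \<beta> * D)\<^sup>2"
    by (auto simp: W_def power2_eq_square algebra_simps)
  have 2: "ln ((D - 1) * \<beta>\<^sup>2) = ln (D - 1) + 2 * ln \<beta>" "ln (\<beta>\<^sup>2) = 2 * ln \<beta>"
    "ln ((1 - \<beta>)\<^sup>2) = 2 * ln (1 - \<beta>)" "ln (\<beta> * (1 - \<beta>)) = ln \<beta> + ln (1 - \<beta>)"
    "ln (\<beta> * (1 - \<beta> * D)) = ln \<beta> + ln (1 - \<beta> * D)"
    "ln ((1 - \<beta> * D)\<^sup>2) = 2 * ln (1 - \<beta> * D)"
    using real_bounds \<beta>_pos by (auto simp: ln_mult ln_realpow)
  have 3: "D \<noteq> 0" using d2 by simp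
  show ?thesis
    unfolding P_def 1 2 Phi_def mult.commute[of D \<beta>]
    using 3 by (simp add: field_simps power2_eq_square)
qed

section \<open>Existence and uniqueness of the maximizer on \<open>C\<close>\<close>

lemma compact_C: "compact C"
proof -
  have C: "C = {p. 0 \<le> fst p \<and> fst p \<le> \<beta> \<and> 0 \<le> snd p \<and> snd p \<le> \<beta> - fst p \<and>
      0 \<le> W (fst p) (snd p)}"
    by (auto simp: C_def)
  have "closed C"
    unfolding C W_def by (intro closed_Collect_conj closed_Collect_le continuous_intros)
  moreover have "C \<subseteq> cbox (0, 0) (\<beta>, \<beta>)"
    by (auto simp: C_def cbox_Pair_eq)
  ultimately show ?thesis
    using compact_cbox compact_Int_closed by (metis inf.absorb_iff2)
qed

lemma continuous_on_P: "continuous_on C (\<lambda>p. P (fst p) (snd p))"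
proof -
  have xlx: "continuous_on C (\<lambda>p. f p * ln (f p))"
    if "continuous_on C f" "\<And>p. p \<in> C \<Longrightarrow> 0 \<le> f p" for f :: "real \<times> real \<Rightarrow> real"
    by (rule continuous_on_compose2[OF continuous_on_x_ln_x that(1)]) (use that(2) in auto)
  have W: "continuous_on C (\<lambda>p. W (fst p) (snd p))"
    unfolding W_def by (intro continuous_intros)
  show ?thesis
    unfolding P_def
    by (intro continuous_on_add continuous_on_diff continuous_on_minus
        continuous_on_mult_left continuous_on_mult_right xlx W continuous_intros)
      (use real_bounds in \<open>auto simp: C_def\<close>)
qed

text \<open>Taking an arbitrary maximizer serves twice later: it locates the one given by
  compactness and excludes ties elsewhere.\<close>

lemma max_on_C_unique:
  assumes G: "\<And>s. 0 < s \<Longrightarrow> s < \<beta> - c0 l \<beta> \<Longrightarrow> G_fun d l \<beta> s > 0"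
    and p: "(\<rho>, z) \<in> C" and max: "\<And>r x. (r, x) \<in> C \<Longrightarrow> P r x \<le> P \<rho> z"
  shows "\<rho> = \<beta>\<^sup>2 \<and> z = (D - 1) * \<beta>\<^sup>2"
proof -
  have "\<rho> < \<beta>"
  proof (rule ccontr)
    assume "\<not> \<rho> < \<beta>"
    then have "\<rho> = \<beta>" "z = 0" using p by (auto simp: C_def)
    then show False using rho_beta_not_max max by (meson not_le)
  qed
  then obtain y where y: "0 < y" "y < \<beta> - \<rho>" "0 < W \<rho> y"
      "(D - 1) * (\<beta> - \<rho> - y)\<^sup>2 = y * W \<rho> y"
    using fibre_crit_exists by blast
  have "(\<rho>, y) \<in> C" using y p by (auto simp: C_def)
  then have "z = y" using fibre_max[OF y p] max by (meson not_le)
  note z = y[folded this]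
  have "\<rho> \<noteq> 0" using rho_zero_not_max[of z] z max by (metis diff_zero not_le)
  then have "0 < \<rho>" using p by (auto simp: C_def)
  \<comment> \<open>A radius within which \<open>\<rho>\<close> can vary at fixed \<open>z\<close>
    without leaving \<open>C\<close>; \<open>W\<close> changes at rate \<open>D\<close>.\<close>
  define e where "e = Min {\<rho>, \<beta> - \<rho> - z, W \<rho> z / D}"
  have e: "0 < e" "e \<le> \<rho>" "e \<le> \<beta> - \<rho> - z" "e \<le> W \<rho> z / D"
    using z \<open>0 < \<rho>\<close> real_bounds by (auto simp: e_def)
  have "P r z \<le> P \<rho> z" if "\<bar>\<rho> - r\<bar> < e" for r
  proof -
    have "- (e * D) \<le> (r - \<rho>) * D"
      using that real_bounds by (metis abs_le_iff less_eq_real_def abs_minus_commute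
          minus_le_iff mult_minus_left mult_right_mono of_nat_0_le_iff)
    moreover have "e * D \<le> W \<rho> z" using e real_bounds by (simp add: field_simps)
    moreover have "W r z = W \<rho> z + (r - \<rho>) * D" by (simp add: W_def algebra_simps)
    ultimately have "0 \<le> W r z" by linarith
    then show ?thesis using that e z by (intro max) (auto simp: C_def)
  qed
  then have crit: "- ln \<rho> + (L - 1) * ln (1 - 2 * \<beta> + \<rho>) - 2 * (L - 1) * ln (\<beta> - \<rho>)
     + 2 * L * ln (\<beta> - \<rho> - z) - L * ln (W \<rho> z) = 0"
    using DERIV_local_max[OF P_deriv_rho[OF \<open>0 < \<rho>\<close> \<open>\<rho> < \<beta>\<close> z(1-3)] e(1)] by blast
  note E = crit_imp_E_zero[OF \<open>0 < \<rho>\<close> \<open>\<rho> < \<beta>\<close> z crit]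
  have "\<beta> - \<rho> = \<beta> * (1 - \<beta>)"
  proof (rule at_most_one_zero_if_deriv_pos[of 0 \<beta> E E'])
    show "(E has_real_derivative E' x) (at x)" if "x \<in> {0<..<\<beta>}" for x
      using that by (intro E_deriv) auto
    show "0 < E' x" if "x \<in> {0<..<\<beta>}" "E x = 0" for x
      using that by (intro E'_pos_at_zero G) auto
  qed (use E E_opt \<open>0 < \<rho>\<close> \<open>\<rho> < \<beta>\<close> \<beta>_pos real_bounds in auto)
  moreover from this have "z = (D - 1) * (\<beta> * (1 - \<beta>)) * (\<beta> / (1 - \<beta>))"
    using E(1) t_fun_opt by simp
  then have "z = (D - 1) * \<beta>\<^sup>2" using real_bounds by (simp add: power2_eq_square)
  ultimately show ?thesis by (simp add: power2_eq_square algebra_simps)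
qed

section \<open>Transfer to \<open>Psi\<close> on the closure of the region\<close>

lemma opt_in_Reg: "(\<beta>\<^sup>2, L * ((D - 1) * \<beta>\<^sup>2)) \<in> Reg d l \<beta>"
proof -
  have "\<beta> * \<beta> < 1 * \<beta>" using \<beta>_pos real_bounds by (intro mult_strict_right_mono) auto
  then have "\<beta>\<^sup>2 < \<beta>" by (simp add: power2_eq_square)
  moreover have "0 < L * ((D - 1) * \<beta>\<^sup>2)" using \<beta>_pos real_bounds by simp
  \<comment> \<open>This is the gap to the lower bound on \<open>\<theta>\<close>; the gap to the
    upper bound is \<open>L * (\<beta> * (1 - \<beta> * D))\<close>.\<close>
  moreover have "0 < L / D * (1 - \<beta> * D)\<^sup>2" using \<beta>_pos real_bounds by simp
  then have "2 * L * \<beta> - L * \<beta>\<^sup>2 - L / D < L * ((D - 1) * \<beta>\<^sup>2)"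
    using real_bounds by (simp add: power2_eq_square field_simps)
  moreover have "0 < L * (\<beta> * (1 - \<beta> * D))" using \<beta>_pos real_bounds by simp
  then have "L * ((D - 1) * \<beta>\<^sup>2) < L * \<beta> - L * \<beta>\<^sup>2"
    by (simp add: power2_eq_square algebra_simps)
  ultimately show ?thesis using \<beta>_pos by (simp add: Reg_def)
qed

lemma closure_Reg_subset: "closure (Reg d l \<beta>) \<subseteq> (\<lambda>(\<rho>, x). (\<rho>, L * x)) ` C"
proof (rule closure_minimal)
  show "closed ((\<lambda>(\<rho>, x). (\<rho>, L * x)) ` C)"
    unfolding case_prod_beta
    by (rule compact_imp_closed, rule compact_continuous_image[OF _ compact_C])
      (intro continuous_intros)
  show "Reg d l \<beta> \<subseteq> (\<lambda>(\<rho>, x). (\<rho>, L * x)) ` C"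
  proof
    fix p assume p: "p \<in> Reg d l \<beta>"
    obtain \<rho> \<theta> where [simp]: "p = (\<rho>, \<theta>)" by (rule prod.exhaust)
    have "0 < D / L * (\<theta> - (2 * L * \<beta> - L * \<rho> - L / D))"
      using p real_bounds by (simp add: Reg_def)
    also have "\<dots> = W \<rho> (\<theta> / L)" using real_bounds by (simp add: W_def field_simps)
    finally have "(\<rho>, \<theta> / L) \<in> C" using p real_bounds by (auto simp: C_def Reg_def field_simps)
    then show "p \<in> (\<lambda>(\<rho>, x). (\<rho>, L * x)) ` C"
      using real_bounds by (intro image_eqI[of _ _ "(\<rho>, \<theta> / L)"]) auto
  qed
qed

text \<open>Compactness provides a maximizer on \<open>C\<close>, necessarily the candidate. A point
  with the same value would be a maximizer too, hence equal to it.\<close>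

lemma Psi_less_opt:
  assumes G: "\<And>s. 0 < s \<Longrightarrow> s < \<beta> - c0 l \<beta> \<Longrightarrow> G_fun d l \<beta> s > 0"
    and q: "q \<in> closure (Reg d l \<beta>)" "q \<noteq> (\<beta>\<^sup>2, L * ((D - 1) * \<beta>\<^sup>2))"
  shows "Psi d l \<beta> q < Psi d l \<beta> (\<beta>\<^sup>2, L * ((D - 1) * \<beta>\<^sup>2))"
proof -
  obtain \<rho> x where x: "(\<rho>, x) \<in> C" "q = (\<rho>, L * x)"
    using q(1) closure_Reg_subset by auto
  obtain p where p: "p \<in> C" "\<And>q. q \<in> C \<Longrightarrow> P (fst q) (snd q) \<le> P (fst p) (snd p)"
    using continuous_attains_sup[OF compact_C _ continuous_on_P] x by blast
  have "P r y \<le> P (fst p) (snd p)" if "(r, y) \<in> C" for r y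
    using p(2)[OF that] by simp
  with max_on_C_unique[OF G, of "fst p" "snd p"] p(1)
  have "fst p = \<beta>\<^sup>2" "snd p = (D - 1) * \<beta>\<^sup>2" by auto
  with p(2) have max: "P r y \<le> P (\<beta>\<^sup>2) ((D - 1) * \<beta>\<^sup>2)" if "(r, y) \<in> C" for r y
    using that by fastforce
  have "P \<rho> x \<noteq> P (\<beta>\<^sup>2) ((D - 1) * \<beta>\<^sup>2)"
    using max_on_C_unique[OF G x(1)] max q(2) x(2) by auto
  with max[OF x(1)] show ?thesis unfolding x(2) Psi_eq_P by simp
qed

end

theorem lemma3p5:
  fixes d l :: nat and \<beta> :: real
  assumes "2 \<le> d" and "2 \<le> l"
    and "0 < \<beta>" and "\<beta> < 1 / real d"
    and "\<beta> < (4 - sqrt 2) / 7 \<or> 3 \<le> d"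
    and "\<And>s. 0 < s \<Longrightarrow> s < \<beta> - c0 l \<beta> \<Longrightarrow> G_fun d l \<beta> s > 0"
  shows "(\<exists>!p. is_arg_max (Psi d l \<beta>) (\<lambda>p. p \<in> closure (Reg d l \<beta>)) p)
    \<and> is_arg_max (Psi d l \<beta>) (\<lambda>p. p \<in> closure (Reg d l \<beta>))
         (\<beta>\<^sup>2, real l * (real d - 1) * \<beta>\<^sup>2)
    \<and> Psi d l \<beta> (\<beta>\<^sup>2, real l * (real d - 1) * \<beta>\<^sup>2) = 2 * Phi d l \<beta>"
proof -
  interpret region d l \<beta> using assms by unfold_locales
  let ?o = "(\<beta>\<^sup>2, real l * (real d - 1) * \<beta>\<^sup>2)"
  have o: "?o \<in> closure (Reg d l \<beta>)"
    using opt_in_Reg closure_subset by (auto simp: mult.assoc)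
  have less: "Psi d l \<beta> q < Psi d l \<beta> ?o" if "q \<in> closure (Reg d l \<beta>)" "q \<noteq> ?o" for q
    using Psi_less_opt[of q] assms(6) that by (simp add: mult.assoc)
  have arg: "is_arg_max (Psi d l \<beta>) (\<lambda>p. p \<in> closure (Reg d l \<beta>)) ?o"
    using o less unfolding is_arg_max_def by (metis less_asym')
  moreover have "q = ?o" if "is_arg_max (Psi d l \<beta>) (\<lambda>p. p \<in> closure (Reg d l \<beta>)) q" for q
    using that o less unfolding is_arg_max_def by blast
  moreover have "Psi d l \<beta> ?o = 2 * Phi d l \<beta>"
    using P_opt Psi_eq_P by (simp add: mult.assoc)
  ultimately show ?thesis by blast
qed

end
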